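(* Suppose $\alpha=\omega(\log k)$ (with $\alpha\mid k$). Then $\alpha$-way set-associative LRU with full flushing is $(1+1/\operatorname{poly}(k))$-competitive with LRU with high probability using $(1+\Theta(\sqrt{\log(k)/\alpha}))$-resource augmentation on all request sequences (of arbitrary length).
   Context: Paging: $\mathcal{A}_k$ is algorithm $\mathcal{A}$ on an initially empty cache of size $k$; $C(\mathcal{A}_k,\sigma)$ is its number of misses on $\sigma$. LRU evicts the least recently accessed cached item on a miss with full cache. $\alpha$-way set-associative LRU with cache size $k$: pick a fully random hash $h:\mathcal{U}\to[k/\alpha]$, split the cache into $k/\alpha$ buckets of $\alpha$ slots each running an independent LRU$_\alpha$; serve request $x$ in bucket $h(x)$. With full flushing: additionally keep a counter of cache misses, and for an arbitrary constant $d\ge2$, every $k^d$ misses evict all items in the cache, draw a new fully random hash function, and reset the counter. $\mathcal{A}$ is $c$-competitive with $\mathcal{B}$ with probability $p$ using $r$-resource augmentation on a class of sequences if for every $\sigma$ in it, $\Pr[C(\mathcal{A}_k,\sigma)\le c\,C(\mathcal{B}_{k'},\sigma)+O(1)]\ge p$ with $k=rk'$ (oblivious adversary; randomness over hash functions). "With high probability" means with probability $1-1/\operatorname{poly}(k)$. *)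

theory Defs
  imports "HOL-Probability.Probability" "HOL-Library.Landau_Symbols"
begin

text \<open>
  A cache content is a list ordered by recency of access, most recent item first. Hence
  truncating to the capacity \<open>k\<close> after a miss evicts the least recently accessed item
  precisely if the cache was full.
\<close>

definition lru_step :: "nat \<Rightarrow> 'u \<Rightarrow> 'u list \<Rightarrow> 'u list" where
  "lru_step k x c = (if x \<in> set c then x # remove1 x c else take k (x # c))"

fun lru_misses :: "nat \<Rightarrow> 'u list \<Rightarrow> 'u list \<Rightarrow> nat" where
  "lru_misses k c [] = 0"
| "lru_misses k c (x # \<sigma>) = (if x \<in> set c then 0 else 1) + lru_misses k (lru_step k x c) \<sigma>"

definition lru_cost :: "nat \<Rightarrow> 'u list \<Rightarrow> nat" where
  "lru_cost k \<sigma> = lru_misses k [] \<sigma>"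

text \<open>
  In \<open>sa_misses \<alpha> T H e n b \<sigma>\<close>, the function \<open>H e\<close> is the hash function in use after \<open>e\<close>
  flushes, \<open>n\<close> is the miss counter, \<open>b i\<close> is the content of bucket \<open>i\<close>, and a flush takes
  place right after the miss that makes the counter reach \<open>T\<close>. The threshold \<open>T\<close> is real
  because the exponent in \<open>k powr d\<close> need not be an integer.
\<close>

fun sa_misses ::
  "nat \<Rightarrow> real \<Rightarrow> (nat \<Rightarrow> 'u \<Rightarrow> nat) \<Rightarrow> nat \<Rightarrow> nat \<Rightarrow> (nat \<Rightarrow> 'u list) \<Rightarrow> 'u list \<Rightarrow> nat" where
  "sa_misses \<alpha> T H e n b [] = 0"
| "sa_misses \<alpha> T H e n b (x # \<sigma>) =
    (let i = H e x; b' = b(i := lru_step \<alpha> x (b i)) in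
      if x \<in> set (b i) then sa_misses \<alpha> T H e n b' \<sigma>
      else if real (Suc n) \<ge> T then Suc (sa_misses \<alpha> T H (Suc e) 0 (\<lambda>_. []) \<sigma>)
      else Suc (sa_misses \<alpha> T H e (Suc n) b' \<sigma>))"

definition sa_lru_flush_cost ::
  "nat \<Rightarrow> real \<Rightarrow> nat \<Rightarrow> (nat \<Rightarrow> 'u \<Rightarrow> nat) \<Rightarrow> 'u list \<Rightarrow> nat" where
  "sa_lru_flush_cost \<alpha> d k H \<sigma> = sa_misses \<alpha> (real k powr d) H 0 0 (\<lambda>_. []) \<sigma>"

definition random_hashes :: "nat \<Rightarrow> (nat \<Rightarrow> 'u \<Rightarrow> nat) measure" where
  "random_hashes m =
    PiM UNIV (\<lambda>_::nat. PiM UNIV (\<lambda>_::'u. measure_pmf (pmf_of_set {..<m})))"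

text \<open>
  The randomized algorithm is given by its probability spaces \<open>M k\<close> and costs \<open>A k\<close>. The
  ratio \<open>c\<close>, the probability \<open>p\<close> and the augmentation \<open>r\<close> are functions of \<open>k\<close>; the additive
  constant \<open>B\<close> is uniform in both \<open>k\<close> and the request sequence. The equation for \<open>k'\<close> is
  a conjunct, so that the notion is not vacuous when \<open>k / r k\<close> is not an integer.
\<close>

definition competitive ::
  "(nat \<Rightarrow> 'w measure) \<Rightarrow> (nat \<Rightarrow> 'w \<Rightarrow> 'u list \<Rightarrow> nat) \<Rightarrow> (nat \<Rightarrow> 'u list \<Rightarrow> nat) \<Rightarrow>
    'u list set \<Rightarrow> (nat \<Rightarrow> real) \<Rightarrow> (nat \<Rightarrow> real) \<Rightarrow> (nat \<Rightarrow> real) \<Rightarrow> bool" where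
  "competitive M A A' S c p r \<longleftrightarrow>
    (\<exists>B::real. \<forall>\<^sub>F k in at_top. \<exists>k'::nat. real k = r k * real k' \<and>
      (\<forall>\<sigma>\<in>S. measure (M k)
          {\<omega> \<in> space (M k). real (A k \<omega> \<sigma>) \<le> c k * real (A' k' \<sigma>) + B} \<ge> p k))"

end

theory Submission imports Defs begin

text \<open>
  Let \<open>k'\<close> be the size of the LRU cache and \<open>N\<close> the number of misses between two flushes, and
  call the part of the request sequence between two flushes an epoch. Recency lists describe all
  caches at once: LRU holds the first \<open>k'\<close> entries of the list of past requests ordered by
  recency, and bucket \<open>i\<close> the first \<open>\<alpha>\<close> entries among those hashed to \<open>i\<close>. Hence, as long as no
  bucket receives more than \<open>\<alpha>\<close> items of the cache of an LRU started on an empty cache at the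
  beginning of the epoch, every hit of this LRU is a hit of the set-associative cache. Within its
  first \<open>N\<close> misses this LRU has at most \<open>N\<close> different cache contents, so by a Chernoff bound and
  the union bound a fresh hash function overflows some bucket only with a probability \<open>q\<close> that is
  an arbitrarily small inverse polynomial in \<open>k\<close>. An epoch without overflow costs LRU at least
  \<open>N - k'\<close> misses, so it earns a credit of \<open>\<delta> * N / 2\<close> towards the ratio \<open>1 + \<delta>\<close>, whereas an
  epoch with overflow consumes a credit of at most \<open>N\<close>. Sequences of any length are handled by
  induction: with a credit of \<open>y\<close>, the ratio is violated with probability at most
  \<open>Q * 2 powr (- y / N)\<close>, provided that \<open>16 * q \<le> Q * \<delta>\<close>.
\<close>

subsection \<open>Recency lists\<close>

definition touch :: "'u \<Rightarrow> 'u list \<Rightarrow> 'u list" where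
  "touch x R = x # remove1 x R"

definition recency :: "'u list \<Rightarrow> 'u list \<Rightarrow> 'u list" where
  "recency R \<sigma> = fold touch \<sigma> R"

lemma recency_simps [simp]:
  "recency R [] = R"
  "recency R (x # \<sigma>) = recency (touch x R) \<sigma>"
  "recency R (\<sigma> @ \<tau>) = recency (recency R \<sigma>) \<tau>"
  by (simp_all add: recency_def)

lemma distinct_touch [simp]: "distinct R \<Longrightarrow> distinct (touch x R)"
  by (simp add: touch_def)

lemma distinct_recency [simp]: "distinct R \<Longrightarrow> distinct (recency R \<sigma>)"
  by (induction \<sigma> arbitrary: R) auto

lemma set_touch: "distinct R \<Longrightarrow> set (touch x R) = insert x (set R)"
  by (auto simp: touch_def)

lemma set_recency: "distinct R \<Longrightarrow> set (recency R \<sigma>) = set R \<union> set \<sigma>"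
  by (induction \<sigma> arbitrary: R) (auto simp: set_touch)

lemma touch_append:
  "touch x (R @ S) = (if x \<in> set R then touch x R @ S else touch x R @ remove1 x S)"
  by (simp add: touch_def remove1_append remove1_idem)

lemma length_touch: "length (touch x R) = (if x \<in> set R then length R else Suc (length R))"
  by (auto simp: touch_def length_remove1 dest: length_pos_if_in_set)

text \<open>If \<open>x\<close> is among the first \<open>k\<close> entries, only these are
  permuted; otherwise \<open>x\<close> goes in front of them before truncation, and its old position
  further down does not matter.\<close>

lemma lru_step_take: "lru_step k x (take k R) = take k (touch x R)"
proof -
  have R: "R = take k R @ drop k R" by simp
  show ?thesis
  proof (cases "x \<in> set (take k R)")
    case True
    have "take k (touch x R) = take k (touch x (take k R) @ drop k R)"
      using True by (subst R) (simp only: touch_append if_True)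
    also have "\<dots> = touch x (take k R)"
      using True by (auto simp: length_touch)
    finally show ?thesis using True by (simp add: lru_step_def touch_def)
  next
    case False
    have "take k (touch x R) = take k (touch x (take k R) @ remove1 x (drop k R))"
      using False by (subst R) (simp only: touch_append if_False)
    also have "\<dots> = take k (touch x (take k R))"
      using False by (cases "length R \<le> k") (auto simp: length_touch)
    finally show ?thesis using False by (simp add: lru_step_def touch_def remove1_idem)
  qed
qed

lemma lru_misses_Cons_take:
  "lru_misses k (take k R) (x # \<sigma>) =
    (if x \<in> set (take k R) then 0 else 1) + lru_misses k (take k (touch x R)) \<sigma>"
  by (simp add: lru_step_take)

text \<open>From here on runs are unfolded with \<open>lru_misses_Cons_take\<close>, which keeps
  every cache in the form \<open>take k R\<close>.\<close>

declare lru_misses.simps(2) [simp del]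

lemma lru_misses_append:
  "lru_misses k (take k R) (\<sigma> @ \<tau>) =
    lru_misses k (take k R) \<sigma> + lru_misses k (take k (recency R \<sigma>)) \<tau>"
  by (induction \<sigma> arbitrary: R) (simp_all add: lru_misses_Cons_take)

text \<open>
  A run started on an empty cache loses at most one hit for every slot that it has not filled yet.
\<close>

lemma lru_misses_restart_aux:
  "lru_misses k (take k R) \<sigma> \<le> lru_misses k (take k (R @ S)) \<sigma> + (k - length R)"
proof (induction \<sigma> arbitrary: R S)
  case (Cons x \<sigma>)
  show ?case
  proof (cases "k \<le> length R")
    case True
    then show ?thesis by simp
  next
    case False
    then have short: "take k R = R" "length R < k" by auto
    show ?thesis
    proof (cases "x \<in> set R")
      case True
      then have "x \<in> set (take k R)" using short(1) by simp
      then show ?thesis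
        unfolding lru_misses_Cons_take touch_append
        using Cons[of "touch x R" S] True by (simp add: length_touch)
    next
      case False
      then show ?thesis
        unfolding lru_misses_Cons_take touch_append
        using Cons[of "touch x R" "remove1 x S"] short(2) by (simp add: length_touch)
    qed
  qed
qed simp

lemma lru_misses_restart:
  "lru_misses k [] \<sigma> \<le> lru_misses k (take k R) \<sigma> + k"
  using lru_misses_restart_aux[of k "[]" \<sigma> R] by simp

text \<open>A hit only permutes the cache. This is what limits the number of different caches by the
  number of misses.\<close>

lemma set_take_recency_no_miss:
  assumes "distinct R" "lru_misses k (take k R) \<sigma> = 0"
  shows "set (take k (recency R \<sigma>)) = set (take k R)"
  using assms
proof (induction \<sigma> arbitrary: R)
  case (Cons x \<sigma>)
  then have x: "x \<in> set (take k R)" and 0: "lru_misses k (take k (touch x R)) \<sigma> = 0"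
    by (auto simp: lru_misses_Cons_take split: if_splits)
  have "set (take k (touch x R)) = set (take k R)"
    using x Cons.prems(1) by (auto simp: lru_step_take[symmetric] lru_step_def)
  then show ?case using Cons.IH[of "touch x R"] Cons.prems(1) 0 by simp
qed simp

text \<open>Filtering commutes with the move to the front, and a request to another bucket only
  moves an item that the filter drops anyway.\<close>

lemma bucket_touch:
  "take a (filter P (touch x R)) =
    (if P x then lru_step a x (take a (filter P R)) else take a (filter P R))"
  by (simp add: lru_step_take) (simp add: touch_def filter_remove1)

subsection \<open>Epochs\<close>

text \<open>
  The number of misses up to and including the next flush, and the requests left after it;
  the latter is also empty if there is no flush.
\<close>

fun sa_epoch ::
  "nat \<Rightarrow> real \<Rightarrow> ('u \<Rightarrow> nat) \<Rightarrow> nat \<Rightarrow> (nat \<Rightarrow> 'u list) \<Rightarrow> 'u list \<Rightarrow> nat \<times> 'u list" where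
  "sa_epoch \<alpha> T h n b [] = (0, [])"
| "sa_epoch \<alpha> T h n b (x # \<sigma>) =
    (let b' = b(h x := lru_step \<alpha> x (b (h x))) in
      if x \<in> set (b (h x)) then sa_epoch \<alpha> T h n b' \<sigma>
      else if real (Suc n) \<ge> T then (1, \<sigma>)
      else (case sa_epoch \<alpha> T h (Suc n) b' \<sigma> of (m, \<rho>) \<Rightarrow> (Suc m, \<rho>)))"

lemma sa_misses_epoch:
  "sa_misses \<alpha> T H e n b \<sigma> =
    fst (sa_epoch \<alpha> T (H e) n b \<sigma>) +
    sa_misses \<alpha> T H (Suc e) 0 (\<lambda>_. []) (snd (sa_epoch \<alpha> T (H e) n b \<sigma>))"
  by (induction \<sigma> arbitrary: n b) (auto simp: Let_def split: prod.splits)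

text \<open>After a flush the run reads only the tail of the hash sequence, so the analysis can
  restart with a fresh sequence.\<close>

lemma sa_misses_shift:
  "sa_misses \<alpha> T H (Suc e) n b \<sigma> = sa_misses \<alpha> T (\<lambda>i. H (Suc i)) e n b \<sigma>"
  by (induction \<sigma> arbitrary: e n b) (auto simp: Let_def)

text \<open>Each request causes at most one flush, so a run reads only finitely many hash values.
  Measurability of its cost rests on this.\<close>

lemma sa_misses_cong:
  assumes "\<And>i x. i < e + length \<sigma> \<Longrightarrow> x \<in> set \<sigma> \<Longrightarrow> H i x = H' i x"
  shows "sa_misses \<alpha> T H e n b \<sigma> = sa_misses \<alpha> T H' e n b \<sigma>"
  using assms
proof (induction \<sigma> arbitrary: e n b)
  case (Cons x \<sigma>)
  have "H e x = H' e x" by (rule Cons.prems) auto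
  moreover have "sa_misses \<alpha> T H e' n' b' \<sigma> = sa_misses \<alpha> T H' e' n' b' \<sigma>"
    if "e' \<le> Suc e" for e' n' b'
    using that by (intro Cons.IH Cons.prems) auto
  ultimately show ?case by (auto simp: Let_def)
qed simp

lemma snd_sa_epoch:
  "(\<exists>\<pi>. \<sigma> = \<pi> @ snd (sa_epoch \<alpha> T h n b \<sigma>)) \<and>
   (\<sigma> \<noteq> [] \<longrightarrow> length (snd (sa_epoch \<alpha> T h n b \<sigma>)) < length \<sigma>)"
proof (induction \<sigma> arbitrary: n b)
  case (Cons x \<sigma>)
  obtain b' where b': "b' = b(h x := lru_step \<alpha> x (b (h x)))" by simp
  have "snd (sa_epoch \<alpha> T h n b (x # \<sigma>)) \<in>
      {snd (sa_epoch \<alpha> T h n b' \<sigma>), \<sigma>, snd (sa_epoch \<alpha> T h (Suc n) b' \<sigma>)}"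
    by (auto simp: b' Let_def split: prod.splits)
  moreover have "(\<exists>\<pi>. x # \<sigma> = \<pi> @ \<rho>) \<and> length \<rho> < Suc (length \<sigma>)"
    if "\<rho> \<in> {snd (sa_epoch \<alpha> T h n b' \<sigma>), \<sigma>, snd (sa_epoch \<alpha> T h (Suc n) b' \<sigma>)}" for \<rho>
  proof -
    from that consider "\<rho> = \<sigma>" | n where "\<rho> = snd (sa_epoch \<alpha> T h n b' \<sigma>)" by auto
    then have "\<exists>\<pi>. \<sigma> = \<pi> @ \<rho>"
      using Cons[of _ b'] by cases auto
    then obtain \<pi> where "\<sigma> = \<pi> @ \<rho>" ..
    then show ?thesis by (auto intro!: exI[of _ "x # \<pi>"])
  qed
  ultimately show ?case by simp
qed simp

text \<open>The second assumption says that \<open>N\<close> is the least natural number that is at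
  least \<open>T\<close>. Either a flush ends the epoch with the counter at exactly
  \<open>N\<close>, or the requests run out.\<close>

lemma fst_sa_epoch:
  assumes "n < N" "\<And>j. real j \<ge> T \<longleftrightarrow> j \<ge> N"
  shows "n + fst (sa_epoch \<alpha> T h n b \<sigma>) \<le> N \<and>
    (snd (sa_epoch \<alpha> T h n b \<sigma>) = [] \<or> n + fst (sa_epoch \<alpha> T h n b \<sigma>) = N)"
  using assms(1)
proof (induction \<sigma> arbitrary: n b)
  case (Cons x \<sigma>)
  obtain b' where b': "b' = b(h x := lru_step \<alpha> x (b (h x)))" by simp
  show ?case
    using Cons.prems Cons.IH[of n b'] Cons.IH[of "Suc n" b'] assms(2)[of "Suc n"]
    by (auto simp: b'[symmetric] Let_def simp del: of_nat_Suc split: prod.splits)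
qed simp

text \<open>
  The simulation loses track of the buckets once LRU has made \<open>N\<close> misses, but by then it is
  ahead of everything that the epoch can still cost.
\<close>

lemma sa_epoch_le_lru_aux:
  assumes N: "\<And>j. real j \<ge> T \<longleftrightarrow> j \<ge> N"
    and "distinct R" "n < N" "n \<le> l"
    and "\<And>i. b i = take \<alpha> (filter (\<lambda>y. h y = i) R)"
    and "\<And>\<pi> \<rho> i. \<sigma> = \<pi> @ \<rho> \<Longrightarrow> l + lru_misses k (take k R) \<pi> < N \<Longrightarrow>
      card {x \<in> set (take k (recency R \<pi>)). h x = i} \<le> \<alpha>"
  shows "\<exists>\<pi>. \<sigma> = \<pi> @ snd (sa_epoch \<alpha> T h n b \<sigma>) \<and>
    n + fst (sa_epoch \<alpha> T h n b \<sigma>) \<le> l + lru_misses k (take k R) \<pi>"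
  using assms(2-)
proof (induction \<sigma> arbitrary: R n l b)
  case (Cons x \<sigma>)
  note ih = Cons.IH and prems = Cons.prems
  show ?case
  proof (cases "N \<le> l")
    case True
    obtain \<pi> where "x # \<sigma> = \<pi> @ snd (sa_epoch \<alpha> T h n b (x # \<sigma>))"
      using snd_sa_epoch by blast
    moreover have "n + fst (sa_epoch \<alpha> T h n b (x # \<sigma>)) \<le> l"
      using fst_sa_epoch[OF prems(2) N] True by (meson le_trans)
    ultimately show ?thesis by (blast intro: trans_le_add1)
  next
    case False
    define b' where "b' = b(h x := lru_step \<alpha> x (b (h x)))"
    define R' where "R' = touch x R"
    define l' where "l' = l + (if x \<in> set (take k R) then 0 else 1)"
    have R': "distinct R'" using prems(1) by (simp add: R'_def)
    have b': "b' i = take \<alpha> (filter (\<lambda>y. h y = i) R')" for i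
      by (auto simp: b'_def R'_def bucket_touch prems(4))
    have mis: "l + lru_misses k (take k R) (x # \<pi>) = l' + lru_misses k (take k R') \<pi>" for \<pi>
      by (simp add: l'_def R'_def lru_misses_Cons_take)
    have good: "card {x \<in> set (take k (recency R' \<pi>)). h x = i} \<le> \<alpha>"
      if "\<sigma> = \<pi> @ \<rho>" "l' + lru_misses k (take k R') \<pi> < N" for \<pi> \<rho> i
      using prems(5)[of "x # \<pi>" \<rho> i] that mis[of \<pi>] by (simp add: R'_def)
    \<comment> \<open>The items of the LRU cache that belong to this bucket come first in the
      filtered recency list, and there are at most \<open>\<alpha>\<close> of them, so truncation
      keeps them all.\<close>
    have hit: "x \<in> set (b (h x))" if x: "x \<in> set (take k R)"
    proof -
      let ?P = "\<lambda>y. h y = h x"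
      have "card {y \<in> set (take k R). h y = h x} \<le> \<alpha>"
        using prems(5)[of "[]" "x # \<sigma>" "h x"] False by simp
      then have "length (filter ?P (take k R)) \<le> \<alpha>"
        using prems(1) by (simp add: distinct_card[symmetric])
      then have "set (filter ?P (take k R)) \<subseteq> set (take \<alpha> (filter ?P (take k R @ drop k R)))"
        by (subst filter_append) simp
      then show ?thesis using x by (auto simp: prems(4))
    qed
    have step: "\<exists>\<pi>. x # \<sigma> = \<pi> @ snd (sa_epoch \<alpha> T h n' b' \<sigma>) \<and>
        n' + fst (sa_epoch \<alpha> T h n' b' \<sigma>) \<le> l + lru_misses k (take k R) \<pi>"
      if n': "n' < N" "n' \<le> l'" for n'
    proof -
      obtain \<pi> where "\<sigma> = \<pi> @ snd (sa_epoch \<alpha> T h n' b' \<sigma>)"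
        "n' + fst (sa_epoch \<alpha> T h n' b' \<sigma>) \<le> l' + lru_misses k (take k R') \<pi>"
        using ih[OF R' n' b'] good by blast
      then show ?thesis using mis[of \<pi>] by (intro exI[of _ "x # \<pi>"]) simp
    qed
    consider "x \<in> set (b (h x))" | "x \<notin> set (b (h x))" "real (Suc n) \<ge> T"
      | "x \<notin> set (b (h x))" "\<not> real (Suc n) \<ge> T" by blast
    then show ?thesis
    proof cases
      case 1
      then show ?thesis using step[of n] prems(2,3) by (simp add: b'_def l'_def)
    next
      case 2
      \<comment> \<open>The flush ends the epoch at \<open>x\<close>. By \<open>hit\<close> the
        request is a miss of LRU as well, so both counts grow by one and \<open>n \<le> l\<close>
        carries over.\<close>
      then show ?thesis using hit prems(3)
        by (intro exI[of _ "[x]"]) (auto simp: lru_misses_Cons_take)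
    next
      case 3
      then have "Suc n < N" using N[of "Suc n"] by simp
      moreover have "Suc n \<le> l'" using 3 hit prems(3) by (auto simp: l'_def)
      ultimately show ?thesis using 3 step[of "Suc n"]
        by (auto simp: b'_def[symmetric] Let_def split: prod.splits)
    qed
  qed
qed simp

subsection \<open>Random hash functions\<close>

definition random_hash :: "nat \<Rightarrow> ('u \<Rightarrow> nat) measure" where
  "random_hash m = PiM UNIV (\<lambda>_::'u. measure_pmf (pmf_of_set {..<m}))"

lemma space_random_hash [simp]: "space (random_hash m) = UNIV"
  by (simp add: random_hash_def space_PiM)

lemma random_hashes_eq: "random_hashes m = PiM UNIV (\<lambda>_::nat. random_hash m)"
  by (simp add: random_hashes_def random_hash_def)

lemma space_random_hashes [simp]: "space (random_hashes m) = UNIV"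
  by (simp add: random_hashes_eq space_PiM)

lemma prob_space_random_hash: "prob_space (random_hash m)"
  unfolding random_hash_def by (intro prob_space_PiM measure_pmf.prob_space_axioms)

lemma prob_space_random_hashes: "prob_space (random_hashes m)"
  unfolding random_hashes_eq by (intro prob_space_PiM prob_space_random_hash)

lemma measurable_random_hash:
  "(\<lambda>h. h x) \<in> random_hash m \<rightarrow>\<^sub>M count_space UNIV"
  unfolding random_hash_def
  using measurable_component_singleton[of x UNIV "\<lambda>_. measure_pmf (pmf_of_set {..<m})"]
  by (simp add: measurable_pmf_measure2)

lemma measurable_random_hashes:
  "(\<lambda>H. H e x) \<in> random_hashes m \<rightarrow>\<^sub>M count_space UNIV"
  unfolding random_hashes_eq
  using measurable_compose[OF measurable_component_singleton[of e UNIV "\<lambda>_. random_hash m"]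
      measurable_random_hash] by simp

text \<open>The universe of items may be uncountable, so measurability in the product space is not
  automatic. An event that depends on finitely many coordinates with countable range is a countable
  union of cylinders.\<close>

lemma sets_Collect_finite_dependence:
  fixes X :: "'i \<Rightarrow> 'a \<Rightarrow> 'b::countable"
  assumes "finite J" and X: "\<And>j. j \<in> J \<Longrightarrow> X j \<in> M \<rightarrow>\<^sub>M count_space UNIV"
    and P: "\<And>\<omega> \<omega>'. (\<And>j. j \<in> J \<Longrightarrow> X j \<omega> = X j \<omega>') \<Longrightarrow> P \<omega> \<Longrightarrow> P \<omega>'"
  shows "{\<omega> \<in> space M. P \<omega>} \<in> sets M"
proof -
  let ?G = "(\<lambda>\<omega>. restrict (\<lambda>j. X j \<omega>) J) ` {\<omega> \<in> space M. P \<omega>}"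
  let ?A = "\<lambda>g. {\<omega> \<in> space M. \<forall>j\<in>J. X j \<omega> = g j}"
  have "?G \<subseteq> (\<Pi>\<^sub>E j\<in>J. UNIV)" by auto
  then have "countable ?G"
    by (rule countable_subset) (use \<open>finite J\<close> in \<open>intro countable_PiE; simp\<close>)
  moreover have "?A g \<in> sets M" for g
  proof (rule sets.sets_Collect_finite_All[OF _ \<open>finite J\<close>])
    fix j assume "j \<in> J"
    have "{\<omega> \<in> space M. X j \<omega> = g j} = X j -` {g j} \<inter> space M" by auto
    then show "{\<omega> \<in> space M. X j \<omega> = g j} \<in> sets M"
      using measurable_sets[OF X[OF \<open>j \<in> J\<close>], of "{g j}"] by simp
  qed
  ultimately have "(\<Union>g\<in>?G. ?A g) \<in> sets M"
    by (intro sets.countable_UN') auto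
  moreover have "(\<Union>g\<in>?G. ?A g) = {\<omega> \<in> space M. P \<omega>}"
  proof (intro equalityI subsetI)
    fix \<omega> assume "\<omega> \<in> (\<Union>g\<in>?G. ?A g)"
    then obtain \<omega>' where "P \<omega>'" "\<omega> \<in> space M" "\<And>j. j \<in> J \<Longrightarrow> X j \<omega> = X j \<omega>'" by auto
    then show "\<omega> \<in> {\<omega> \<in> space M. P \<omega>}" using P[of \<omega>' \<omega>] by simp
  next
    fix \<omega> assume "\<omega> \<in> {\<omega> \<in> space M. P \<omega>}"
    then show "\<omega> \<in> (\<Union>g\<in>?G. ?A g)"
      by (intro UN_I[of "restrict (\<lambda>j. X j \<omega>) J"]) auto
  qed
  ultimately show ?thesis by simp
qed

lemma sets_random_hash_Collect:
  assumes "finite U" "\<And>h h'. (\<And>x. x \<in> U \<Longrightarrow> h x = h' x) \<Longrightarrow> P h \<Longrightarrow> P h'"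
  shows "{h. P h} \<in> sets (random_hash m)"
proof -
  have "{h \<in> space (random_hash m). P h} \<in> sets (random_hash m)"
    using assms by (rule sets_Collect_finite_dependence[OF _ measurable_random_hash])
  then show ?thesis by simp
qed

lemma sets_bucket_overflow:
  assumes "finite C"
  shows "{h. \<alpha> < card {x \<in> C. h x = i}} \<in> sets (random_hash m)"
proof (rule sets_random_hash_Collect[OF assms])
  fix h h' :: "'a \<Rightarrow> nat" assume eq: "\<And>x. x \<in> C \<Longrightarrow> h x = h' x"
    and "\<alpha> < card {x \<in> C. h x = i}"
  moreover have "{x \<in> C. h x = i} = {x \<in> C. h' x = i}" using eq by auto
  ultimately show "\<alpha> < card {x \<in> C. h' x = i}" by simp
qed

lemma sets_random_hashes_sa_misses:
  "{H. Q (sa_misses \<alpha> T H 0 0 (\<lambda>_. []) \<sigma>)} \<in> sets (random_hashes m)"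
proof -
  have "{H \<in> space (random_hashes m). Q (sa_misses \<alpha> T H 0 0 (\<lambda>_. []) \<sigma>)} \<in> sets (random_hashes m)"
  proof (rule sets_Collect_finite_dependence)
    show "finite ({..<length \<sigma>} \<times> set \<sigma>)" by simp
    show "(\<lambda>H. H (fst j) (snd j)) \<in> random_hashes m \<rightarrow>\<^sub>M count_space UNIV" for j :: "nat \<times> 'a"
      by (rule measurable_random_hashes)
  next
    fix H H' :: "nat \<Rightarrow> 'a \<Rightarrow> nat"
    assume eq: "\<And>j. j \<in> {..<length \<sigma>} \<times> set \<sigma> \<Longrightarrow> H (fst j) (snd j) = H' (fst j) (snd j)"
      and Q: "Q (sa_misses \<alpha> T H 0 0 (\<lambda>_. []) \<sigma>)"
    have "H i x = H' i x" if "i < 0 + length \<sigma>" "x \<in> set \<sigma>" for i x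
      using eq[of "(i, x)"] that by simp
    then have "sa_misses \<alpha> T H 0 0 (\<lambda>_. []) \<sigma> = sa_misses \<alpha> T H' 0 0 (\<lambda>_. []) \<sigma>"
      by (rule sa_misses_cong)
    then show "Q (sa_misses \<alpha> T H' 0 0 (\<lambda>_. []) \<sigma>)" using Q by simp
  qed
  then show ?thesis by simp
qed

text \<open>By \<open>PiM_iter\<close> the sequence is distributed like a first function
  \<open>h\<close> followed by an independent sequence \<open>H\<close>. Integrating over
  \<open>h\<close> charges \<open>a\<close> on \<open>B\<close> only and \<open>g\<close>
  everywhere.\<close>

lemma measure_random_hashes_le:
  assumes E: "E \<in> sets (random_hashes m)" and B: "B \<in> sets (random_hash m)"
    and "measure (random_hash m) B \<le> q" "0 \<le> a" "0 \<le> g"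
    and bad: "\<And>h. h \<in> B \<Longrightarrow> measure (random_hashes m) {H. case_nat h H \<in> E} \<le> a"
    and good: "\<And>h. h \<notin> B \<Longrightarrow> measure (random_hashes m) {H. case_nat h H \<in> E} \<le> g"
  shows "measure (random_hashes m) E \<le> a * q + g"
proof -
  let ?M = "random_hash m" and ?S = "random_hashes m"
  interpret M: prob_space ?M by (rule prob_space_random_hash)
  interpret S: prob_space ?S by (rule prob_space_random_hashes)
  interpret seq: sequence_space ?M by unfold_locales
  let ?f = "\<lambda>(s, \<omega>). case_nat s \<omega>"
  have f: "?f \<in> ?M \<Otimes>\<^sub>M ?S \<rightarrow>\<^sub>M ?S"
    unfolding random_hashes_eq by measurable
  have sets_f: "?f -` E \<inter> space (?M \<Otimes>\<^sub>M ?S) \<in> sets (?M \<Otimes>\<^sub>M ?S)"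
    using measurable_sets[OF f E] .
  have "emeasure ?S E = emeasure (distr (?M \<Otimes>\<^sub>M ?S) ?S ?f) E"
    unfolding random_hashes_eq seq.PiM_iter ..
  also have "\<dots> = emeasure (?M \<Otimes>\<^sub>M ?S) (?f -` E \<inter> space (?M \<Otimes>\<^sub>M ?S))"
    by (rule emeasure_distr[OF f E])
  also have "\<dots> = (\<integral>\<^sup>+h. emeasure ?S (Pair h -` (?f -` E \<inter> space (?M \<Otimes>\<^sub>M ?S))) \<partial>?M)"
    by (rule S.emeasure_pair_measure_alt[OF sets_f])
  also have "\<dots> \<le> (\<integral>\<^sup>+h. ennreal a * indicator B h + ennreal g \<partial>?M)"
  proof (rule nn_integral_mono)
    fix h
    have "Pair h -` (?f -` E \<inter> space (?M \<Otimes>\<^sub>M ?S)) = {H. case_nat h H \<in> E}"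
      by (auto simp: space_pair_measure)
    then show "emeasure ?S (Pair h -` (?f -` E \<inter> space (?M \<Otimes>\<^sub>M ?S)))
        \<le> ennreal a * indicator B h + ennreal g"
      using bad[of h] good[of h] assms(4,5)
      by (cases "h \<in> B") (auto simp: S.emeasure_eq_measure ennreal_plus[symmetric]
          intro!: ennreal_leI simp del: ennreal_plus)
  qed
  also have "\<dots> = ennreal (a * measure ?M B + g)"
    using B assms(4,5)
    by (subst nn_integral_add) (auto simp: nn_integral_cmult M.emeasure_eq_measure
        ennreal_mult' M.prob_space[simplified])
  finally have "measure ?S E \<le> a * measure ?M B + g"
    using assms(4,5) by (simp add: S.emeasure_eq_measure del: ennreal_plus)
  also have "\<dots> \<le> a * q + g"
    using assms(3,4) by (simp add: mult_left_mono)
  finally show ?thesis .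
qed

text \<open>Chernoff bound: Markov's inequality for \<open>exp (t * X)\<close>, where
  \<open>X\<close> is the load of bucket \<open>i\<close>. By independence each item of
  \<open>C\<close> contributes a factor \<open>1 + (exp t - 1) / m\<close>, which is at most
  \<open>exp ((exp t - 1) / m)\<close>.\<close>

lemma random_hash_bucket_tail:
  fixes C :: "'u set"
  assumes "finite C" "0 < m" "i < m" "0 \<le> t"
  shows "measure (random_hash m) {h. \<alpha> < card {x \<in> C. h x = i}} \<le>
    exp (real (card C) * (exp t - 1) / real m - t * real \<alpha>)"
proof -
  let ?M = "random_hash m :: ('u \<Rightarrow> nat) measure"
  let ?p = "\<lambda>_::'u. measure_pmf (pmf_of_set {..<m})"
  let ?w = "\<lambda>j. ennreal (if j = i then exp t else 1)"
  let ?f = "\<lambda>h::'u \<Rightarrow> nat. \<Prod>x\<in>C. ?w (h x)"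
  interpret M: prob_space ?M by (rule prob_space_random_hash)
  interpret pp: product_prob_space ?p UNIV by unfold_locales
  have ne: "{..<m} \<noteq> {}" using assms by auto
  have B: "{h::'u \<Rightarrow> nat. \<alpha> < card {x \<in> C. h x = i}} \<in> sets ?M"
    by (rule sets_bucket_overflow[OF \<open>finite C\<close>])
  have one: "(\<integral>\<^sup>+j. ?w j \<partial>measure_pmf (pmf_of_set {..<m})) = ennreal (1 + (exp t - 1) / m)"
  proof -
    have "(\<Sum>j<m. if j = i then exp t else 1) = (\<Sum>j<m. (if j = i then exp t - 1 else 0) + 1)"
      by (intro sum.cong) auto
    also have "\<dots> = exp t - 1 + m" using \<open>i < m\<close> by (simp add: sum.distrib)
    finally have s: "(\<Sum>j<m. if j = i then exp t else 1) = exp t - 1 + m" .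
    have "(\<integral>\<^sup>+j. ?w j \<partial>measure_pmf (pmf_of_set {..<m})) = (\<Sum>j<m. ?w j) / ennreal m"
      using ne by (simp add: nn_integral_pmf_of_set ennreal_of_nat_eq_real_of_nat)
    also have "(\<Sum>j<m. ?w j) = ennreal (exp t - 1 + m)"
      by (subst sum_ennreal) (auto simp: s)
    also have "\<dots> / ennreal m = ennreal ((exp t - 1 + m) / m)"
      using \<open>0 < m\<close> \<open>0 \<le> t\<close> by (intro divide_ennreal) auto
    finally show ?thesis using \<open>0 < m\<close> by (simp add: add_divide_distrib add.commute)
  qed
  \<comment> \<open>Only the finitely many coordinates in \<open>C\<close> matter; restricting to
    them gives a finite product measure, over which the integral of a product factorizes.\<close>
  have "(\<integral>\<^sup>+h. ?f h \<partial>?M) = (\<integral>\<^sup>+h. ?f (restrict h C) \<partial>?M)"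
    by (simp cong: prod.cong)
  also have "\<dots> = (\<integral>\<^sup>+h. ?f h \<partial>distr ?M (PiM C ?p) (\<lambda>h. restrict h C))"
    unfolding random_hash_def by (subst nn_integral_distr) (auto intro!: borel_measurable_prod)
  also have "\<dots> = (\<integral>\<^sup>+h. ?f h \<partial>PiM C ?p)"
    unfolding random_hash_def using \<open>finite C\<close> by (subst pp.distr_PiM_restrict_finite) auto
  also have "\<dots> = (\<Prod>x\<in>C. \<integral>\<^sup>+j. ?w j \<partial>?p x)"
    using \<open>finite C\<close> by (intro pp.product_nn_integral_prod) auto
  also have "\<dots> = ennreal ((1 + (exp t - 1) / m) ^ card C)"
    using \<open>0 \<le> t\<close> unfolding one by (simp add: ennreal_power del: ennreal_plus)
  finally have mgf: "(\<integral>\<^sup>+h. ?f h \<partial>?M) = ennreal ((1 + (exp t - 1) / m) ^ card C)" .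
  have f: "?f h = ennreal (exp (t * card {x \<in> C. h x = i}))" for h
  proof -
    have "?f h = ennreal (\<Prod>x\<in>C. if h x = i then exp t else 1)"
      by (subst prod_ennreal) auto
    also have "(\<Prod>x\<in>C. if h x = i then exp t else 1) = exp t ^ card {x \<in> C. h x = i}"
      using \<open>finite C\<close> by (simp add: prod.If_cases Int_def)
    finally show ?thesis by (simp add: exp_of_nat_mult[symmetric] mult.commute)
  qed
  have "ennreal (exp (t * \<alpha>)) * emeasure ?M {h. \<alpha> < card {x \<in> C. h x = i}}
      = (\<integral>\<^sup>+h. ennreal (exp (t * \<alpha>)) * indicator {h. \<alpha> < card {x \<in> C. h x = i}} h \<partial>?M)"
    using B by (simp add: nn_integral_cmult)
  also have "\<dots> \<le> (\<integral>\<^sup>+h. ?f h \<partial>?M)"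
    unfolding f using \<open>0 \<le> t\<close>
    by (intro nn_integral_mono) (auto simp: indicator_def mult_left_mono)
  finally have "exp (t * \<alpha>) * measure ?M {h. \<alpha> < card {x \<in> C. h x = i}}
      \<le> (1 + (exp t - 1) / m) ^ card C"
    unfolding mgf using \<open>0 \<le> t\<close>
    by (simp add: M.emeasure_eq_measure ennreal_mult'[symmetric])
  also have "\<dots> \<le> exp ((exp t - 1) / m) ^ card C"
    using \<open>0 \<le> t\<close> by (intro power_mono exp_ge_add_one_self) auto
  also have "\<dots> = exp (real (card C) * (exp t - 1) / m)"
    by (simp add: exp_of_nat_mult[symmetric])
  finally show ?thesis by (simp add: exp_diff field_simps)
qed

subsection \<open>Overflowing hash functions\<close>

text \<open>The prefixes are not cut off at the end of the epoch: that end depends on the hash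
  function, whereas a union bound needs sets that are fixed in advance.\<close>

definition lru_caches :: "nat \<Rightarrow> nat \<Rightarrow> 'u list \<Rightarrow> 'u set set" where
  "lru_caches k N \<sigma> =
    {set (take k (recency [] \<pi>)) |\<pi> \<rho>. \<sigma> = \<pi> @ \<rho> \<and> lru_misses k [] \<pi> < N}"

definition overflowing :: "nat \<Rightarrow> nat \<Rightarrow> nat \<Rightarrow> 'u list \<Rightarrow> ('u \<Rightarrow> nat) set" where
  "overflowing \<alpha> k N \<sigma> = {h. \<exists>C\<in>lru_caches k N \<sigma>. \<exists>i. \<alpha> < card {x \<in> C. h x = i}}"

lemma lru_cachesD:
  assumes "C \<in> lru_caches k N \<sigma>"
  shows "C \<subseteq> set \<sigma>" "finite C" "card C \<le> k"
proof -
  obtain \<pi> \<rho> where C: "C = set (take k (recency [] \<pi>))" "\<sigma> = \<pi> @ \<rho>"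
    using assms by (auto simp: lru_caches_def)
  show "C \<subseteq> set \<sigma>"
    using set_take_subset[of k "recency [] \<pi>"] by (auto simp: C set_recency)
  show "finite C" by (simp add: C)
  show "card C \<le> k"
    unfolding C by (rule order_trans[OF card_length]) simp
qed

text \<open>One of the two prefixes extends the other without a further miss.\<close>

lemma lru_cache_determined_by_misses:
  assumes "\<sigma> = \<pi> @ \<rho>" "\<sigma> = \<pi>' @ \<rho>'" "lru_misses k [] \<pi> = lru_misses k [] \<pi>'"
  shows "set (take k (recency [] \<pi>)) = set (take k (recency [] \<pi>'))"
proof -
  have *: "set (take k (recency [] (\<pi> @ \<tau>))) = set (take k (recency [] \<pi>))"
    if "lru_misses k [] (\<pi> @ \<tau>) = lru_misses k [] \<pi>" for \<pi> \<tau> :: "'a list"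
    using that lru_misses_append[of k "[]" \<pi> \<tau>]
    by (simp add: set_take_recency_no_miss)
  from assms(1,2) consider \<tau> where "\<pi> = \<pi>' @ \<tau>" | \<tau> where "\<pi>' = \<pi> @ \<tau>"
    by (auto simp: append_eq_append_conv2)
  then show ?thesis
    using *[of \<pi>] *[of \<pi>'] assms(3) by cases auto
qed

lemma card_lru_caches: "finite (lru_caches k N \<sigma>)" "card (lru_caches k N \<sigma>) \<le> N"
proof -
  define A where "A = {\<pi>. (\<exists>\<rho>. \<sigma> = \<pi> @ \<rho>) \<and> lru_misses k [] \<pi> < N}"
  \<comment> \<open>All prefixes in \<open>A\<close> with \<open>j\<close> misses share one cache,
    so any of them can represent it. For values of \<open>j\<close> that do not occur the choice is
    arbitrary and harmless.\<close>
  define c where "c j = set (take k (recency [] (SOME \<pi>. \<pi> \<in> A \<and> lru_misses k [] \<pi> = j)))" for j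
  have "set (take k (recency [] \<pi>)) = c (lru_misses k [] \<pi>)" if \<pi>: "\<pi> \<in> A" for \<pi>
  proof -
    define \<pi>' where "\<pi>' = (SOME \<pi>'. \<pi>' \<in> A \<and> lru_misses k [] \<pi>' = lru_misses k [] \<pi>)"
    have "\<pi>' \<in> A \<and> lru_misses k [] \<pi>' = lru_misses k [] \<pi>"
      unfolding \<pi>'_def by (rule someI[of _ \<pi>]) (use \<pi> in simp)
    moreover obtain \<rho> where "\<sigma> = \<pi> @ \<rho>" using \<pi> by (auto simp: A_def)
    moreover obtain \<rho>' where "\<sigma> = \<pi>' @ \<rho>'" using calculation(1) by (auto simp: A_def)
    ultimately have "set (take k (recency [] \<pi>)) = set (take k (recency [] \<pi>'))"
      by (intro lru_cache_determined_by_misses) auto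
    then show ?thesis by (simp add: c_def \<pi>'_def)
  qed
  then have sub: "lru_caches k N \<sigma> \<subseteq> c ` {..<N}"
    by (fastforce simp: lru_caches_def A_def)
  then show "finite (lru_caches k N \<sigma>)" by (rule finite_subset) simp
  show "card (lru_caches k N \<sigma>) \<le> N"
    using card_mono[OF _ sub] card_image_le[of "{..<N}" c] by simp
qed

lemma sets_overflowing: "overflowing \<alpha> k N \<sigma> \<in> sets (random_hash m)"
  unfolding overflowing_def
proof (rule sets_random_hash_Collect[of "set \<sigma>"])
  fix h h' :: "'a \<Rightarrow> nat"
  assume eq: "\<And>x. x \<in> set \<sigma> \<Longrightarrow> h x = h' x"
    and "\<exists>C\<in>lru_caches k N \<sigma>. \<exists>i. \<alpha> < card {x \<in> C. h x = i}"
  then obtain C i where C: "C \<in> lru_caches k N \<sigma>" "\<alpha> < card {x \<in> C. h x = i}" by blast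
  have "{x \<in> C. h x = i} = {x \<in> C. h' x = i}"
    using eq lru_cachesD(1)[OF C(1)] by auto
  then show "\<exists>C\<in>lru_caches k N \<sigma>. \<exists>i. \<alpha> < card {x \<in> C. h' x = i}"
    using C by auto
qed simp

text \<open>Union bound over at most \<open>N\<close> caches and \<open>m\<close> buckets, with the
  Chernoff bound for each pair.\<close>

lemma measure_overflowing_le:
  fixes \<sigma> :: "'u list"
  assumes "0 < m" "0 \<le> t"
  shows "measure (random_hash m) (overflowing \<alpha> k N \<sigma>) \<le>
    real N * real m * exp (real k * (exp t - 1) / real m - t * real \<alpha>)"
proof -
  let ?M = "random_hash m :: ('u \<Rightarrow> nat) measure"
  let ?A = "\<lambda>C i. {h::'u \<Rightarrow> nat. \<alpha> < card {x \<in> C. h x = i}}"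
  let ?p = "exp (real k * (exp t - 1) / real m - t * real \<alpha>)"
  let ?J = "lru_caches k N \<sigma> \<times> {..<m}"
  interpret M: prob_space ?M by (rule prob_space_random_hash)
  have A: "?A C i \<in> sets ?M" if "C \<in> lru_caches k N \<sigma>" for C i
    by (rule sets_bucket_overflow[OF lru_cachesD(2)[OF that]])
  \<comment> \<open>\<open>overflowing\<close> quantifies over all indices \<open>i\<close>; almost
    surely only those below \<open>m\<close> receive items of \<open>\<sigma>\<close>, which leaves
    a finite union.\<close>
  have "AE h in ?M. h x < m" for x
    unfolding random_hash_def
    using \<open>0 < m\<close> by (intro AE_PiM_component measure_pmf.prob_space_axioms)
      (auto simp: AE_measure_pmf_iff lessThan_empty_iff)
  then have "AE h in ?M. \<forall>x\<in>set \<sigma>. h x < m"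
    by (intro AE_finite_allI) auto
  then have "AE h in ?M. h \<in> overflowing \<alpha> k N \<sigma> \<longrightarrow> h \<in> (\<Union>(C, i)\<in>?J. ?A C i)"
  proof eventually_elim
    case (elim h)
    show ?case
    proof
      assume "h \<in> overflowing \<alpha> k N \<sigma>"
      then obtain C i where C: "C \<in> lru_caches k N \<sigma>" "\<alpha> < card {x \<in> C. h x = i}"
        by (auto simp: overflowing_def)
      then have "{x \<in> C. h x = i} \<noteq> {}" by (metis card.empty not_less_zero)
      then have "i < m" using elim lru_cachesD(1)[OF C(1)] by auto
      then show "h \<in> (\<Union>(C, i)\<in>?J. ?A C i)" using C by auto
    qed
  qed
  then have "measure ?M (overflowing \<alpha> k N \<sigma>) \<le> measure ?M (\<Union>(C, i)\<in>?J. ?A C i)"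
    using A card_lru_caches(1)[of k N \<sigma>]
    by (intro M.finite_measure_mono_AE sets.finite_UN) auto
  also have "\<dots> \<le> (\<Sum>(C, i)\<in>?J. measure ?M (?A C i))"
  proof -
    have "(\<lambda>(C, i). ?A C i) ` ?J \<subseteq> sets ?M" using A by auto
    then show ?thesis
      using M.finite_measure_subadditive_finite[of ?J "\<lambda>(C, i). ?A C i"]
        card_lru_caches(1)[of k N \<sigma>] by (simp add: split_beta)
  qed
  also have "\<dots> \<le> (\<Sum>(C, i)\<in>?J. ?p)"
  proof (rule sum_mono, clarify)
    fix C i assume C: "C \<in> lru_caches k N \<sigma>" and "i < m"
    have "measure ?M (?A C i) \<le> exp (real (card C) * (exp t - 1) / real m - t * real \<alpha>)"
      using C assms \<open>i < m\<close> by (intro random_hash_bucket_tail lru_cachesD)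
    also have "\<dots> \<le> ?p"
      using lru_cachesD(3)[OF C] \<open>0 \<le> t\<close> by (simp add: divide_right_mono mult_right_mono)
    finally show "measure ?M (?A C i) \<le> ?p" .
  qed
  also have "\<dots> = real (card (lru_caches k N \<sigma>)) * real m * ?p"
    by (simp add: card_cartesian_product split_beta)
  also have "\<dots> \<le> real N * real m * ?p"
    using card_lru_caches(2)[of k N \<sigma>] by (intro mult_right_mono) auto
  finally show ?thesis .
qed

lemma sa_epoch_le_lru:
  assumes "\<And>j. real j \<ge> T \<longleftrightarrow> j \<ge> N" "0 < N" "h \<notin> overflowing \<alpha> k N \<sigma>"
  obtains \<pi> where "\<sigma> = \<pi> @ snd (sa_epoch \<alpha> T h 0 (\<lambda>_. []) \<sigma>)"
    "fst (sa_epoch \<alpha> T h 0 (\<lambda>_. []) \<sigma>) \<le> lru_misses k [] \<pi>"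
proof -
  have "card {x \<in> set (take k (recency [] \<pi>)). h x = i} \<le> \<alpha>"
    if "\<sigma> = \<pi> @ \<rho>" "lru_misses k [] \<pi> < N" for \<pi> \<rho> i
  proof -
    have "set (take k (recency [] \<pi>)) \<in> lru_caches k N \<sigma>"
      using that by (auto simp: lru_caches_def)
    then show ?thesis using assms(3) by (auto simp: overflowing_def not_less)
  qed
  then show ?thesis
    using sa_epoch_le_lru_aux[of T N "[]" 0 0 "\<lambda>_. []" \<alpha> h \<sigma> k] assms(1,2) that
    by auto
qed

subsection \<open>The tail of the excess cost\<close>

text \<open>The situation right after a flush: the set-associative cache restarts with empty
  buckets, whereas LRU carries on with the cache described by \<open>R\<close>. The number
  \<open>y\<close> is the credit available.\<close>

definition excess_event ::
  "nat \<Rightarrow> real \<Rightarrow> nat \<Rightarrow> real \<Rightarrow> 'u list \<Rightarrow> real \<Rightarrow> 'u list \<Rightarrow> (nat \<Rightarrow> 'u \<Rightarrow> nat) set" where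
  "excess_event \<alpha> T k \<delta> R y \<sigma> =
    {H. (1 + \<delta>) * lru_misses k (take k R) \<sigma> + y < sa_misses \<alpha> T H 0 0 (\<lambda>_. []) \<sigma>}"

lemma sets_excess_event: "excess_event \<alpha> T k \<delta> R y \<sigma> \<in> sets (random_hashes m)"
  unfolding excess_event_def by (rule sets_random_hashes_sa_misses)

lemma excess_event_mono: "y' \<le> y \<Longrightarrow> excess_event \<alpha> T k \<delta> R y \<sigma> \<subseteq> excess_event \<alpha> T k \<delta> R y' \<sigma>"
  by (auto simp: excess_event_def)

text \<open>Conditions on the hash function of the first epoch. \<open>bad\<close> covers an
  overflow, where at most \<open>N\<close> of the credit is lost; \<open>good\<close> covers an
  epoch without overflow that leaves requests; \<open>last\<close> rules the event out if such an
  epoch leaves none.\<close>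

lemma measure_excess_event_step:
  fixes \<sigma> :: "'u list" and \<delta> a g q y :: real
  assumes N: "\<And>j. real j \<ge> T \<longleftrightarrow> j \<ge> N" "0 < N" and "0 \<le> \<delta>" "0 \<le> a" "0 \<le> g"
    and q: "measure (random_hash m) (overflowing \<alpha> k N \<sigma>) \<le> q"
    and last: "lru_misses k [] \<sigma> \<le> (1 + \<delta>) * lru_misses k (take k R) \<sigma> + y"
    and bad: "\<And>\<rho> R' :: 'u list. length \<rho> < length \<sigma> \<Longrightarrow>
      measure (random_hashes m) (excess_event \<alpha> T k \<delta> R' (y - N) \<rho>) \<le> a"
    and good: "\<And>\<pi> \<rho>. \<sigma> = \<pi> @ \<rho> \<Longrightarrow> length \<rho> < length \<sigma> \<Longrightarrow> N \<le> lru_misses k [] \<pi> \<Longrightarrow>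
      measure (random_hashes m) (excess_event \<alpha> T k \<delta> (recency R \<pi>)
        (y + (1 + \<delta>) * lru_misses k (take k R) \<pi> - N) \<rho>) \<le> g"
  shows "measure (random_hashes m) (excess_event \<alpha> T k \<delta> R y \<sigma>) \<le> a * q + g"
proof (cases "\<sigma> = []")
  case True
  have "0 \<le> q" using q measure_nonneg order_trans by blast
  moreover have "excess_event \<alpha> T k \<delta> R y \<sigma> = {}"
    using True last by (auto simp: excess_event_def)
  ultimately show ?thesis using assms(4,5) by simp
next
  case False
  let ?S = "random_hashes m :: (nat \<Rightarrow> 'u \<Rightarrow> nat) measure"
  let ?E = "excess_event \<alpha> T k \<delta> R y \<sigma>"
  let ?n = "\<lambda>h. fst (sa_epoch \<alpha> T h 0 (\<lambda>_. []) \<sigma>)"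
  let ?r = "\<lambda>h. snd (sa_epoch \<alpha> T h 0 (\<lambda>_. []) \<sigma>)"
  interpret S: prob_space ?S by (rule prob_space_random_hashes)
  \<comment> \<open>Without its first epoch the event has the same form: the credit grows by the
    share that LRU contributes and shrinks by the cost of the epoch.\<close>
  have unfold: "{H. case_nat h H \<in> ?E} = excess_event \<alpha> T k \<delta> (recency R \<pi>)
      (y + (1 + \<delta>) * lru_misses k (take k R) \<pi> - ?n h) (?r h)"
    if \<pi>: "\<sigma> = \<pi> @ ?r h" for h \<pi>
  proof -
    have "lru_misses k (take k R) \<sigma> =
        lru_misses k (take k R) \<pi> + lru_misses k (take k (recency R \<pi>)) (?r h)"
      by (subst \<pi>) (rule lru_misses_append)
    moreover have "sa_misses \<alpha> T (case_nat h H) 0 0 (\<lambda>_. []) \<sigma> =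
        ?n h + sa_misses \<alpha> T H 0 0 (\<lambda>_. []) (?r h)" for H
      by (subst sa_misses_epoch) (simp add: sa_misses_shift)
    ultimately show ?thesis by (auto simp: excess_event_def algebra_simps)
  qed
  have short: "length (?r h) < length \<sigma>" for h
    using snd_sa_epoch[of \<sigma> \<alpha> T h 0] False by blast
  have n_le: "?n h \<le> N" for h
    using fst_sa_epoch[OF N(2,1), of \<alpha> h "\<lambda>_. []" \<sigma>] by simp
  show ?thesis
  proof (rule measure_random_hashes_le[OF sets_excess_event sets_overflowing q assms(4,5)])
    fix h :: "'u \<Rightarrow> nat"
    obtain \<pi> where \<pi>: "\<sigma> = \<pi> @ ?r h" using snd_sa_epoch by blast
    have "0 \<le> (1 + \<delta>) * real (lru_misses k (take k R) \<pi>)" using \<open>0 \<le> \<delta>\<close> by simp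
    then have "y - N \<le> y + (1 + \<delta>) * real (lru_misses k (take k R) \<pi>) - ?n h"
      using n_le[of h] by linarith
    then have "{H. case_nat h H \<in> ?E} \<subseteq> excess_event \<alpha> T k \<delta> (recency R \<pi>) (y - N) (?r h)"
      unfolding unfold[OF \<pi>] by (rule excess_event_mono)
    then have "measure ?S {H. case_nat h H \<in> ?E} \<le>
        measure ?S (excess_event \<alpha> T k \<delta> (recency R \<pi>) (y - N) (?r h))"
      by (rule S.finite_measure_mono[OF _ sets_excess_event])
    then show "measure ?S {H. case_nat h H \<in> ?E} \<le> a"
      using bad[OF short] by (rule order_trans)
  next
    fix h :: "'u \<Rightarrow> nat" assume "h \<notin> overflowing \<alpha> k N \<sigma>"
    then obtain \<pi> where \<pi>: "\<sigma> = \<pi> @ ?r h" "?n h \<le> lru_misses k [] \<pi>"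
      using sa_epoch_le_lru[OF N] by blast
    show "measure ?S {H. case_nat h H \<in> ?E} \<le> g"
    proof (cases "?r h = []")
      case True
      then have "{H. case_nat h H \<in> ?E} = {}"
        unfolding unfold[OF \<pi>(1)] using \<pi> last by (auto simp: excess_event_def)
      then show ?thesis using \<open>0 \<le> g\<close> by simp
    next
      case False
      then have "?n h = N"
        using fst_sa_epoch[OF N(2,1), of \<alpha> h "\<lambda>_. []" \<sigma>] by simp
      then show ?thesis using good[OF \<pi>(1) short] \<pi>(2) unfold[OF \<pi>(1)] by simp
    qed
  qed
qed

text \<open>Earning a credit of \<open>\<delta> * N / 2\<close> multiplies the bound
  \<open>Q * 2 powr (- y / N)\<close> by this power. The saving of \<open>\<delta> / 4\<close> pays
  for overflowing epochs.\<close>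

lemma two_powr_minus_half_le:
  fixes \<delta> :: real
  assumes "0 \<le> \<delta>" "\<delta> \<le> 1"
  shows "2 powr (- \<delta> / 2) \<le> 1 - \<delta> / 4"
proof -
  have "\<delta> / 2 * (2 / 3) \<le> \<delta> / 2 * ln 2"
    using assms ln2_ge_two_thirds by (intro mult_left_mono) auto
  then have "1 + \<delta> / 3 \<le> exp (\<delta> / 2 * ln 2)"
    using exp_ge_add_one_self[of "\<delta> / 2 * ln 2"] by linarith
  then have "1 + \<delta> / 3 \<le> 2 powr (\<delta> / 2)" by (simp add: powr_def)
  then have "2 powr (- \<delta> / 2) \<le> inverse (1 + \<delta> / 3)"
    using assms by (simp add: powr_minus le_imp_inverse_le)
  also have "\<dots> \<le> 1 - \<delta> / 4"
  proof -
    have "\<delta> * \<delta> \<le> \<delta> * 1" using assms by (intro mult_left_mono) auto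
    then have "1 \<le> (1 - \<delta> / 4) * (1 + \<delta> / 3)" by (simp add: algebra_simps)
    then show ?thesis using assms by (simp add: inverse_eq_divide pos_divide_le_eq)
  qed
  finally show ?thesis .
qed

text \<open>
  An overflowing epoch wastes at most \<open>N\<close> of the credit \<open>y\<close>, which doubles the bound, while any
  other completed epoch earns at least \<open>\<delta> * N / 2\<close>, because LRU started on an empty cache makes
  at most \<open>k\<close> more misses than LRU started on any other cache.
\<close>

lemma measure_excess_event_le:
  fixes \<sigma> :: "'u list" and \<delta> q y Q :: real
  assumes N: "\<And>j. real j \<ge> T \<longleftrightarrow> j \<ge> N" "0 < N"
    and \<delta>: "0 \<le> \<delta>" "\<delta> \<le> 1" and Q: "0 < Q" "Q \<le> 1"
    and q: "\<And>\<sigma> :: 'u list. measure (random_hash m) (overflowing \<alpha> k N \<sigma>) \<le> q" "16 * q \<le> Q * \<delta>"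
    and k: "(1 + \<delta>) * k \<le> \<delta> * N / 2" and "k \<le> y"
  shows "measure (random_hashes m) (excess_event \<alpha> T k \<delta> R y \<sigma>) \<le> Q * 2 powr (- y / N)"
  using \<open>k \<le> y\<close>
proof (induction "length \<sigma>" arbitrary: \<sigma> R y rule: less_induct)
  case less
  let ?g = "\<lambda>y. Q * 2 powr (- y / N)"
  interpret S: prob_space "random_hashes m :: (nat \<Rightarrow> 'u \<Rightarrow> nat) measure"
    by (rule prob_space_random_hashes)
  have k': "real k \<le> (1 + \<delta>) * k" using \<delta> by (simp add: algebra_simps)
  have "\<delta> * real N \<le> 1 * real N" using \<delta> by (intro mult_right_mono) auto
  then have kN: "real k \<le> N" using k k' by simp
  \<comment> \<open>The bound for overflow is \<open>4 * 2 powr (- y / N)\<close>. If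
    \<open>k \<le> y - N\<close>, it dominates the induction hypothesis; otherwise
    \<open>y < 2 * N\<close>, so it is at least \<open>1\<close> and holds trivially.\<close>
  have "measure (random_hashes m) (excess_event \<alpha> T k \<delta> R y \<sigma>)
      \<le> (4 / Q * ?g y) * q + (1 - \<delta> / 4) * ?g y"
  proof (rule measure_excess_event_step[OF N \<delta>(1) _ _ q(1)])
    show "0 \<le> 4 / Q * ?g y" "0 \<le> (1 - \<delta> / 4) * ?g y" using Q \<delta> by auto
    \<comment> \<open>Here \<open>k \<le> y\<close> is spent: it covers the additional misses of LRU
      started on an empty cache.\<close>
    have "real (lru_misses k (take k R) \<sigma>) \<le> (1 + \<delta>) * lru_misses k (take k R) \<sigma>"
      using \<delta> by (simp add: algebra_simps)
    then show "lru_misses k [] \<sigma> \<le> (1 + \<delta>) * lru_misses k (take k R) \<sigma> + y"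
      using lru_misses_restart[of k \<sigma> R] less.prems by linarith
  next
    fix \<rho> R' :: "'u list" assume "length \<rho> < length \<sigma>"
    show "measure (random_hashes m) (excess_event \<alpha> T k \<delta> R' (y - N) \<rho>) \<le> 4 / Q * ?g y"
    proof (cases "k \<le> y - N")
      case True
      then have "measure (random_hashes m) (excess_event \<alpha> T k \<delta> R' (y - N) \<rho>) \<le> ?g (y - N)"
        using \<open>length \<rho> < length \<sigma>\<close> by (intro less.hyps)
      also have "- (y - N) / N = - y / N + 1"
        using N(2) by (simp add: field_simps)
      also have "Q * 2 powr (- y / N + 1) = (2 * Q) * 2 powr (- y / N)"
        by (subst powr_add) simp
      also have "\<dots> \<le> 4 * 2 powr (- y / N)"
        using Q by (intro mult_right_mono) auto
      finally show ?thesis using Q by simp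
    next
      case False
      then have "- 2 \<le> - y / N" using kN N(2) by (simp add: field_simps)
      then have "2 powr (- 2) \<le> 2 powr (- y / N)" by (rule powr_mono) simp
      then have "1 \<le> 4 * 2 powr (- y / N)" by (simp add: powr_minus)
      then have "1 \<le> 4 / Q * ?g y" using Q by simp
      with S.prob_le_1 show ?thesis by (rule order_trans)
    qed
  next
    fix \<pi> \<rho> :: "'u list"
    assume *: "\<sigma> = \<pi> @ \<rho>" "length \<rho> < length \<sigma>" "N \<le> lru_misses k [] \<pi>"
    let ?y = "y + (1 + \<delta>) * lru_misses k (take k R) \<pi> - N"
    have "real N - k \<le> lru_misses k (take k R) \<pi>"
      using *(3) lru_misses_restart[of k \<pi> R] by linarith
    then have "(1 + \<delta>) * (real N - k) \<le> (1 + \<delta>) * lru_misses k (take k R) \<pi>"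
      using \<delta> by (intro mult_left_mono) auto
    \<comment> \<open>The gain is at least \<open>(1 + \<delta>) * (N - k) - N = \<delta> * N - (1 +
      \<delta>) * k\<close>, and the assumption \<open>k\<close> bounds the subtracted term by half
      of \<open>\<delta> * N\<close>.\<close>
    then have y: "y + \<delta> * N / 2 \<le> ?y" using k by (simp add: algebra_simps)
    have "0 \<le> \<delta> * N / 2" using \<delta> by simp
    with y less.prems have "k \<le> ?y" by linarith
    then have "measure (random_hashes m) (excess_event \<alpha> T k \<delta> (recency R \<pi>) ?y \<rho>) \<le> ?g ?y"
      using * by (intro less.hyps)
    also have "\<dots> \<le> Q * 2 powr (- y / N + (- \<delta> / 2))"
    proof -
      have "- ?y / N \<le> - (y + \<delta> * N / 2) / N"
        using y N(2) by (intro divide_right_mono) auto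
      also have "\<dots> = - y / N + (- \<delta> / 2)" using N(2) by (simp add: field_simps)
      finally show ?thesis using Q by (intro mult_left_mono powr_mono) auto
    qed
    also have "\<dots> = 2 powr (- \<delta> / 2) * ?g y" by (subst powr_add) simp
    also have "\<dots> \<le> (1 - \<delta> / 4) * ?g y"
      using two_powr_minus_half_le[OF \<delta>] Q by (intro mult_right_mono) auto
    finally show "measure (random_hashes m) (excess_event \<alpha> T k \<delta> (recency R \<pi>) ?y \<rho>)
      \<le> (1 - \<delta> / 4) * ?g y" .
  qed
  also have "\<dots> = (1 - \<delta> / 4 + 4 * q / Q) * ?g y" by (simp add: algebra_simps)
  also have "\<dots> \<le> 1 * ?g y"
    using q(2) Q by (intro mult_right_mono) (auto simp: field_simps)
  finally show ?case by simp
qed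

text \<open>There is no credit at the start, but LRU also starts on an empty cache, so
  \<open>last\<close> holds with \<open>y = 0\<close>. An overflow in the first epoch counts as
  failure; otherwise a completed first epoch leaves a credit of at least
  \<open>\<delta> * N / 2\<close>, hence at least \<open>k\<close>, and
  \<open>measure_excess_event_le\<close> applies.\<close>

lemma measure_excess_event_initial_le:
  fixes \<sigma> :: "'u list" and \<delta> q Q :: real
  assumes N: "\<And>j. real j \<ge> T \<longleftrightarrow> j \<ge> N" "0 < N"
    and \<delta>: "0 \<le> \<delta>" "\<delta> \<le> 1" and Q: "0 < Q" "Q \<le> 1"
    and q: "\<And>\<sigma> :: 'u list. measure (random_hash m) (overflowing \<alpha> k N \<sigma>) \<le> q" "16 * q \<le> Q * \<delta>"
    and k: "(1 + \<delta>) * k \<le> \<delta> * N / 2"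
  shows "measure (random_hashes m) (excess_event \<alpha> T k \<delta> [] 0 \<sigma>) \<le> Q"
proof -
  interpret S: prob_space "random_hashes m :: (nat \<Rightarrow> 'u \<Rightarrow> nat) measure"
    by (rule prob_space_random_hashes)
  have k': "real k \<le> (1 + \<delta>) * k" using \<delta> by (simp add: algebra_simps)
  have "measure (random_hashes m) (excess_event \<alpha> T k \<delta> [] 0 \<sigma>) \<le> 1 * q + Q * (1 - \<delta> / 4)"
  proof (rule measure_excess_event_step[OF N \<delta>(1) _ _ q(1)])
    show "0 \<le> (1 :: real)" "0 \<le> Q * (1 - \<delta> / 4)" using Q \<delta> by auto
    show "lru_misses k [] \<sigma> \<le> (1 + \<delta>) * lru_misses k (take k []) \<sigma> + 0"
      using \<delta> by (simp add: algebra_simps)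
    show "measure (random_hashes m) (excess_event \<alpha> T k \<delta> R' (0 - real N) \<rho>) \<le> 1" for R' \<rho> :: "'u list"
      by (rule S.prob_le_1)
  next
    fix \<pi> \<rho> :: "'u list"
    assume *: "N \<le> lru_misses k [] \<pi>"
    let ?y = "0 + (1 + \<delta>) * lru_misses k (take k []) \<pi> - N"
    have "(1 + \<delta>) * N \<le> (1 + \<delta>) * lru_misses k [] \<pi>"
      using \<delta> * by (intro mult_left_mono) auto
    then have y: "\<delta> * N \<le> ?y" by (simp add: algebra_simps)
    have "0 \<le> \<delta> * N" using \<delta> by simp
    then have y2: "\<delta> * N / 2 \<le> ?y" using y by linarith
    then have "measure (random_hashes m) (excess_event \<alpha> T k \<delta> (recency [] \<pi>) ?y \<rho>)
        \<le> Q * 2 powr (- ?y / N)"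
      using k k' by (intro measure_excess_event_le[OF N \<delta> Q q k]) linarith
    also have "\<dots> \<le> Q * 2 powr (- \<delta> / 2)"
      using y2 N(2) Q by (intro mult_left_mono powr_mono) (auto simp: field_simps)
    also have "\<dots> \<le> Q * (1 - \<delta> / 4)"
      using two_powr_minus_half_le[OF \<delta>] Q by (intro mult_left_mono) auto
    finally show "measure (random_hashes m) (excess_event \<alpha> T k \<delta> (recency [] \<pi>) ?y \<rho>)
        \<le> Q * (1 - \<delta> / 4)" .
  qed
  also have "\<dots> \<le> Q"
  proof -
    have "0 \<le> q" using q(1) measure_nonneg order_trans by blast
    then show ?thesis using q(2) by (simp add: algebra_simps)
  qed
  finally show ?thesis .
qed

subsection \<open>Choice of parameters\<close>

text \<open>With \<open>exp t - 1 \<le> t + t\<^sup>2\<close>, the leading part of the exponent is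
  \<open>\<alpha> * (t\<^sup>2 - \<epsilon> * t)\<close>, which \<open>t = \<epsilon> / 2\<close>
  minimizes.\<close>

lemma overflow_probability_le:
  fixes k k' \<alpha> m :: nat and \<epsilon> :: real and \<sigma> :: "'u list"
  assumes "k = m * \<alpha>" "0 < k" "0 \<le> \<epsilon>" "\<epsilon> \<le> 1" "k' \<le> k * (1 - \<epsilon>)"
  shows "measure (random_hash m) (overflowing \<alpha> k' N \<sigma>) \<le> real N * real m * exp (- (\<epsilon>\<^sup>2 * \<alpha> / 4))"
proof -
  define t where "t = \<epsilon> / 2"
  have t: "0 \<le> t" "t \<le> 1" using assms by (auto simp: t_def)
  have m: "0 < m" using assms by (cases m) auto
  have e: "0 \<le> exp t - 1" "exp t - 1 \<le> t + t\<^sup>2"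
    using exp_bound[OF t] t by auto
  have "real k' * (exp t - 1) / m \<le> (real k * (1 - \<epsilon>)) * (exp t - 1) / m"
    using assms(5) e(1) by (intro divide_right_mono mult_right_mono) auto
  also have "\<dots> = \<alpha> * ((1 - \<epsilon>) * (exp t - 1))" using m assms(1) by simp
  also have "\<dots> \<le> \<alpha> * ((1 - \<epsilon>) * (t + t\<^sup>2))"
    using e assms(4) by (intro mult_left_mono) auto
  finally have "real k' * (exp t - 1) / m - t * \<alpha> \<le> \<alpha> * ((1 - \<epsilon>) * (t + t\<^sup>2)) - t * \<alpha>"
    by simp
  also have "\<dots> = - (\<epsilon>\<^sup>2 * \<alpha> / 4) - \<alpha> * \<epsilon> * t\<^sup>2"
    by (simp add: t_def power2_eq_square field_simps)
  also have "\<dots> \<le> - (\<epsilon>\<^sup>2 * \<alpha> / 4)" using assms(3) by simp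
  finally have "exp (real k' * (exp t - 1) / m - t * \<alpha>) \<le> exp (- (\<epsilon>\<^sup>2 * \<alpha> / 4))"
    by simp
  then have "real N * m * exp (real k' * (exp t - 1) / m - t * \<alpha>) \<le> real N * real m * exp (- (\<epsilon>\<^sup>2 * \<alpha> / 4))"
    by (intro mult_left_mono) auto
  with measure_overflowing_le[OF m t(1)] show ?thesis by (rule order_trans)
qed

lemma sa_lru_flush_cost_bound:
  fixes k k' \<alpha> :: nat and a d \<epsilon> :: real and \<sigma> :: "'u list"
  assumes "\<alpha> dvd k" "1024 \<le> k" "2 \<le> d" "0 < a" "0 \<le> \<epsilon>" "\<epsilon> \<le> 1"
    and \<epsilon>: "\<epsilon>\<^sup>2 * \<alpha> = 4 * (a + d + 2) * ln k" and k': "k' \<le> k * (1 - \<epsilon>)"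
  shows "1 - 1 / k powr a \<le> measure (random_hashes (k div \<alpha>))
    {H \<in> space (random_hashes (k div \<alpha>)).
      sa_lru_flush_cost \<alpha> d k H \<sigma> \<le> (1 + 1 / k powr (1 / 2)) * lru_cost k' \<sigma>}"
proof -
  define m where "m = k div \<alpha>"
  define N where "N = nat \<lceil>k powr d\<rceil>"
  define \<delta> where "\<delta> = k powr (- 1 / 2)"
  define Q where "Q = k powr (- a)"
  let ?S = "random_hashes m :: (nat \<Rightarrow> 'u \<Rightarrow> nat) measure"
  let ?q = "real N * m * exp (- (\<epsilon>\<^sup>2 * \<alpha> / 4))"
  let ?E = "excess_event \<alpha> (k powr d) k' \<delta> [] 0 \<sigma>"
  interpret S: prob_space ?S by (rule prob_space_random_hashes)
  have k: "0 < k" "1 \<le> real k" using assms(2) by auto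
  have km: "k = m * \<alpha>" using assms(1) by (simp add: m_def)
  then have mk: "m \<le> k" using k(1) by (cases \<alpha>) auto
  have sqrt: "32 \<le> sqrt k" using assms(2) by (intro real_le_rsqrt) simp
  have sqrt_powr: "k powr (1 / 2) = sqrt k" by (simp add: powr_half_sqrt)
  have \<delta>_sqrt: "\<delta> = 1 / sqrt k" by (simp add: \<delta>_def powr_minus_divide powr_half_sqrt)
  have \<delta>: "0 \<le> \<delta>" "\<delta> \<le> 1" using sqrt k by (auto simp: \<delta>_sqrt divide_le_eq)
  have Q: "0 < Q" "Q \<le> 1"
    using k assms(4) powr_mono[of "- a" 0 k] by (auto simp: Q_def)
  have "(real k)\<^sup>2 \<le> k powr d"
    using k assms(3) powr_mono[of 2 d k] by simp
  also have "k powr d \<le> N" by (simp add: N_def of_nat_ceiling)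
  finally have kN: "(real k)\<^sup>2 \<le> N" .
  then have N: "0 < N" using k by (cases N) auto
  have threshold: "real j \<ge> k powr d \<longleftrightarrow> j \<ge> N" for j
    by (simp add: N_def nat_le_iff ceiling_le_iff)
  have kk: "sqrt k * sqrt k = k" by simp
  \<comment> \<open>This needs epochs much longer than \<open>k\<close>: since
    \<open>d \<ge> 2\<close>, \<open>\<delta> * N\<close> is at least \<open>k * sqrt k\<close>,
    which dominates \<open>2 * k\<close>.\<close>
  have credit: "(1 + \<delta>) * k' \<le> \<delta> * N / 2"
  proof -
    have "real k * (1 - \<epsilon>) \<le> real k * 1" using assms(5) by (intro mult_left_mono) auto
    then have "(1 + \<delta>) * k' \<le> 2 * real k"
      using \<delta> k' by (intro mult_mono) auto
    also have "\<dots> \<le> sqrt k * k / 2" using mult_right_mono[OF sqrt, of k] by simp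
    also have "sqrt k * k = \<delta> * (real k)\<^sup>2"
      using k kk by (simp add: \<delta>_sqrt field_simps power2_eq_square)
    also have "\<delta> * (real k)\<^sup>2 / 2 \<le> \<delta> * N / 2"
      using kN \<delta> by (simp add: mult_left_mono)
    finally show ?thesis by simp
  qed
  \<comment> \<open>The choice of \<open>\<epsilon>\<close> makes the Chernoff factor
    \<open>k powr (- (a + d + 2))\<close>. Of the exponent, \<open>d\<close> pays for the caches,
    \<open>1\<close> for the buckets and \<open>a\<close> for \<open>Q\<close>; the remaining
    \<open>1\<close> gives \<open>\<delta> * \<delta>\<close>, and one of these factors absorbs the
    constant \<open>32\<close>, as \<open>1024 \<le> k\<close>.\<close>
  have q: "16 * ?q \<le> Q * \<delta>"
  proof -
    have decay: "exp (- (\<epsilon>\<^sup>2 * \<alpha> / 4)) = k powr (- (a + d + 2))"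
      unfolding \<epsilon> using k by (simp add: powr_def field_simps)
    have "1 \<le> k powr d" using k assms(3) by (simp add: ge_one_powr_ge_zero)
    then have "N \<le> 2 * k powr d"
      using of_nat_ceiling[of "k powr d"] by (simp add: N_def) linarith
    then have "?q \<le> (2 * k powr d) * k * exp (- (\<epsilon>\<^sup>2 * \<alpha> / 4))"
      using mk by (intro mult_right_mono mult_mono) auto
    also have "\<dots> = 2 * (k powr d * k powr 1 * k powr (- (a + d + 2)))"
      using k by (simp add: decay)
    also have "k powr d * k powr 1 * k powr (- (a + d + 2)) = k powr (- a + (- 1 / 2) + (- 1 / 2))"
      by (simp only: powr_add[symmetric], rule arg_cong[of _ _ "\<lambda>x. k powr x"]) simp
    also have "\<dots> = Q * \<delta> * \<delta>" by (simp only: Q_def \<delta>_def powr_add)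
    finally have "16 * ?q \<le> Q * \<delta> * (32 * \<delta>)" by simp
    also have "\<dots> \<le> Q * \<delta> * 1"
      using sqrt k Q \<delta> by (intro mult_left_mono) (auto simp: \<delta>_sqrt divide_le_eq)
    finally show ?thesis by simp
  qed
  have E: "?E \<in> sets ?S" by (rule sets_excess_event)
  have "measure ?S ?E \<le> Q"
    using overflow_probability_le[OF km k(1) assms(5,6) k']
    by (intro measure_excess_event_initial_le[OF threshold N \<delta> Q _ q credit])
  then have "1 - Q \<le> measure ?S (space ?S - ?E)"
    using S.prob_compl[OF E] by simp
  also have "space ?S - ?E = {H \<in> space ?S.
      sa_lru_flush_cost \<alpha> d k H \<sigma> \<le> (1 + 1 / k powr (1 / 2)) * lru_cost k' \<sigma>}"
    by (auto simp: excess_event_def sa_lru_flush_cost_def lru_cost_def \<delta>_sqrt sqrt_powr not_less)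
  finally show ?thesis
    by (simp add: Q_def powr_minus_divide m_def)
qed

text \<open>Rounding down loses less than \<open>1 \<le> k * \<epsilon>\<close>, so
  \<open>k - k'\<close> lies between \<open>k * \<epsilon>\<close> and
  \<open>2 * k * \<epsilon>\<close>. Together with \<open>k / 4 \<le> k' \<le> k\<close> this
  determines \<open>k / k' - 1\<close> up to constant factors.\<close>

lemma augmentation_bounds:
  fixes k :: nat and \<epsilon> :: real
  assumes "0 \<le> \<epsilon>" "\<epsilon> \<le> 1 / 2" "1 \<le> k * \<epsilon>" "4 \<le> k"
  defines "k' \<equiv> nat \<lfloor>k * (1 - \<epsilon>)\<rfloor>"
  shows "0 < k'" "k' \<le> k * (1 - \<epsilon>)" "\<epsilon> \<le> k / k' - 1" "k / k' - 1 \<le> 8 * \<epsilon>"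
proof -
  have half: "k * (1 / 2) \<le> k * (1 - \<epsilon>)" using assms by (intro mult_left_mono) auto
  then have "0 \<le> \<lfloor>k * (1 - \<epsilon>)\<rfloor>" by (simp add: le_floor_iff)
  then have kr: "real k' = \<lfloor>k * (1 - \<epsilon>)\<rfloor>" by (simp add: k'_def)
  have lo: "k * (1 - \<epsilon>) - 1 < k'" and hi: "k' \<le> k * (1 - \<epsilon>)" unfolding kr by linarith+
  have quarter: "k / 4 \<le> k'" using lo half assms(4) by linarith
  then have pos: "0 < real k'" using assms(4) by linarith
  show "0 < k'" using pos by simp
  show "k' \<le> k * (1 - \<epsilon>)" by (rule hi)
  have "0 \<le> k * \<epsilon>" using assms(3) by simp
  then have "k' \<le> real k" using hi by (simp add: algebra_simps)
  then have "\<epsilon> * k' \<le> \<epsilon> * k" using assms(1) by (intro mult_left_mono) auto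
  then have "(1 + \<epsilon>) * k' \<le> k" using hi by (simp add: algebra_simps)
  then show "\<epsilon> \<le> k / k' - 1" using pos by (simp add: field_simps)
  have "8 * \<epsilon> * (k / 4) \<le> 8 * \<epsilon> * k'" using quarter assms(1) by (intro mult_left_mono) auto
  then have "k \<le> (1 + 8 * \<epsilon>) * k'" using lo assms(3) by (simp add: algebra_simps)
  then show "k / k' - 1 \<le> 8 * \<epsilon>" using pos by (simp add: field_simps)
qed

theorem theorem13:
  fixes \<alpha> :: "nat \<Rightarrow> nat" and d :: real
  assumes "\<forall>k. \<alpha> k dvd k"
    and "(\<lambda>k. real (\<alpha> k)) \<in> \<omega>(\<lambda>k. ln (real k))"
    and "d \<ge> 2"
  shows "\<exists>b>0. \<forall>a>0. \<exists>r :: nat \<Rightarrow> real.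
    (\<lambda>k. r k - 1) \<in> \<Theta>(\<lambda>k. sqrt (ln (real k) / real (\<alpha> k))) \<and>
    competitive
      (\<lambda>k. random_hashes (k div \<alpha> k))
      (\<lambda>k. sa_lru_flush_cost (\<alpha> k) d k)
      lru_cost
      (UNIV :: 'u list set)
      (\<lambda>k. 1 + 1 / real k powr b)
      (\<lambda>k. 1 - 1 / real k powr a)
      r"
proof (intro exI[of _ "1 / 2 :: real"] conjI allI impI)
  fix a :: real assume a: "0 < a"
  \<comment> \<open>\<open>C * s k\<close> serves as \<open>\<epsilon>\<close> in
    \<open>sa_lru_flush_cost_bound\<close>, which dictates \<open>C\<^sup>2\<close>. The exponent
    \<open>1 / 2\<close> of the ratio is independent of \<open>a\<close>; only the augmentation
    depends on \<open>a\<close>, through \<open>C\<close>.\<close>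
  define C where "C = 2 * sqrt (a + d + 2)"
  define s where "s k = sqrt (ln (real k) / real (\<alpha> k))" for k
  define k' where "k' k = nat \<lfloor>real k * (1 - C * s k)\<rfloor>" for k
  have C2: "C\<^sup>2 = 4 * (a + d + 2)" using a assms(3) by (simp add: C_def power_mult_distrib)
  have "1 \<le> sqrt (a + d + 2)" using a assms(3) by simp
  then have C: "1 \<le> C" "0 < C" unfolding C_def by linarith+
  \<comment> \<open>The factor \<open>4 * C\<^sup>2\<close> is chosen to yield
    \<open>C * s k \<le> 1 / 2\<close>.\<close>
  have "\<forall>\<^sub>F k in at_top. 4 * C\<^sup>2 * norm (ln (real k)) \<le> norm (real (\<alpha> k))"
    using assms(2) C by (intro landau_omega.smallD) auto
  moreover have "\<forall>\<^sub>F k :: nat in at_top. 1024 \<le> k" by (rule eventually_ge_at_top)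
  ultimately have ev: "\<forall>\<^sub>F k in at_top. 1024 \<le> k \<and> 0 \<le> C * s k \<and> C * s k \<le> 1 / 2 \<and>
      1 \<le> k * (C * s k) \<and> (C * s k)\<^sup>2 * \<alpha> k = 4 * (a + d + 2) * ln k"
  proof eventually_elim
    case (elim k)
    have "ln 4 \<le> ln (real k)" using elim(2) by simp
    moreover have "ln (4::real) = 2 * ln 2" using ln_realpow[of 2 2] by simp
    ultimately have ln1: "1 \<le> ln (real k)" using ln2_ge_two_thirds by linarith
    have "0 < k" using elim(2) by simp
    then have \<alpha>: "0 < \<alpha> k" "\<alpha> k \<le> k"
      using assms(1) by (auto intro: dvd_imp_le dvd_pos_nat)
    have s2: "(s k)\<^sup>2 = ln k / \<alpha> k" using ln1 by (simp add: s_def)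
    have s0: "0 \<le> s k" using ln1 by (simp add: s_def)
    have Cs2: "(C * s k)\<^sup>2 * \<alpha> k = 4 * (a + d + 2) * ln k"
      using \<alpha> by (simp add: power_mult_distrib s2 C2)
    have "4 * C\<^sup>2 * ln k \<le> \<alpha> k" using elim(1) ln1 by simp
    then have "(C * s k)\<^sup>2 \<le> (1 / 2)\<^sup>2"
      using \<alpha> by (simp add: power_mult_distrib s2 field_simps)
    then have half: "C * s k \<le> 1 / 2" by (rule power2_le_imp_le) simp
    \<comment> \<open>Prepares \<open>1 \<le> k * s k\<close>, the room that
      \<open>augmentation_bounds\<close> needs for rounding; it holds because a bucket is no larger
      than the cache.\<close>
    have "1 * real (\<alpha> k) \<le> ln k * (real k * real k)"
      using ln1 \<alpha> mult_mono[of 1 "real k" "real (\<alpha> k)" "real k"] by (intro mult_mono) auto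
    then have "1\<^sup>2 \<le> (k * s k)\<^sup>2"
      unfolding power_mult_distrib s2 using \<alpha> by (simp add: power2_eq_square field_simps)
    then have "1 \<le> k * s k" by (rule power2_le_imp_le) (use s0 in simp)
    also have "\<dots> \<le> k * (C * s k)"
      using C s0 mult_right_mono[of 1 C "s k"] by (intro mult_left_mono) auto
    finally show ?case using elim(2) half Cs2 C s0 by simp
  qed
  show "\<exists>r. (\<lambda>k. r k - 1) \<in> \<Theta>(\<lambda>k. sqrt (ln (real k) / real (\<alpha> k))) \<and>
    competitive (\<lambda>k. random_hashes (k div \<alpha> k)) (\<lambda>k. sa_lru_flush_cost (\<alpha> k) d k) lru_cost
      (UNIV :: 'u list set) (\<lambda>k. 1 + 1 / real k powr (1 / 2)) (\<lambda>k. 1 - 1 / real k powr a) r"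
  \<comment> \<open>Defining the augmentation as a quotient makes
    \<open>real k = r k * real k'\<close> exact as soon as \<open>k' k\<close> is positive. Both
    claims concern large \<open>k\<close> only, so division by zero for small \<open>k\<close> is
    harmless.\<close>
  proof (intro exI[of _ "\<lambda>k. real k / real (k' k)"] conjI)
    have "\<forall>\<^sub>F k in at_top. C * s k \<le> k / k' k - 1 \<and> k / k' k - 1 \<le> 8 * (C * s k) \<and> 0 \<le> C * s k"
      using ev by eventually_elim
        (use augmentation_bounds(3,4) in \<open>auto simp: k'_def\<close>)
    then have "\<forall>\<^sub>F k in at_top. norm (k / k' k - 1) \<le> (8 * C) * norm (s k)"
      "\<forall>\<^sub>F k in at_top. norm (k / k' k - 1) \<ge> C * norm (s k)"
      using C by (auto elim!: eventually_mono simp: zero_le_mult_iff)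
    then show "(\<lambda>k. real k / real (k' k) - 1) \<in> \<Theta>(\<lambda>k. sqrt (ln (real k) / real (\<alpha> k)))"
      unfolding s_def[symmetric] using C
      by (intro bigthetaI landau_o.bigI[of "8 * C"] landau_omega.bigI[of C]) auto
  next
    show "competitive (\<lambda>k. random_hashes (k div \<alpha> k)) (\<lambda>k. sa_lru_flush_cost (\<alpha> k) d k) lru_cost
      (UNIV :: 'u list set) (\<lambda>k. 1 + 1 / real k powr (1 / 2)) (\<lambda>k. 1 - 1 / real k powr a)
      (\<lambda>k. real k / real (k' k))"
      unfolding competitive_def
    proof (rule exI[of _ 0], use ev in eventually_elim)
      case (elim k)
      then have k': "0 < k' k" "k' k \<le> k * (1 - C * s k)"
        unfolding k'_def using augmentation_bounds(1,2)[of "C * s k" k] by auto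
      have "1 - 1 / k powr a \<le> measure (random_hashes (k div \<alpha> k))
        {H \<in> space (random_hashes (k div \<alpha> k)).
          sa_lru_flush_cost (\<alpha> k) d k H \<sigma> \<le> (1 + 1 / k powr (1 / 2)) * lru_cost (k' k) \<sigma>}"
        for \<sigma> :: "'u list"
        using assms(1,3) a elim k'(2) by (intro sa_lru_flush_cost_bound[of _ _ _ _ "C * s k"]) auto
      then show ?case using k'(1) by (intro exI[of _ "k' k"]) simp
    qed
  qed
qed simp

end
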